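(* Let $\mathcal{E}=(\mathcal{X},\mathcal{B},\mathcal{P}=\{\mathrm{P}_{\theta}\mid\theta\in\Theta\})$ be a statistical experiment with privileged dominating probability measure $\mathrm{P}_{0}$, and let $\mathcal{B}_0\subseteq\mathcal{B}$ be a sub-$\sigma$-field. Then $\mathcal{B}_0$ (equivalently, the restricted subexperiment $\mathcal{E}_{\mathcal{B}_0}$) is boundedly complete in $\mathcal{E}$ if and only if $$\mathcal{S}_{\mathcal{B}_0}=\mathrm{span}\left(\left\{\mathrm{E}_{0}\left[\frac{d\mathrm{P}_{\theta}}{d\mathrm{P}_{0}}\,\Big|\,\mathcal{B}_0\right]:\theta\in\Theta\right\}\right)$$ is dense in $L^1(\mathcal{B}_0,\mathrm{P}_{0})$.
   Context: A statistical experiment $\mathcal{E}=(\mathcal{X},\mathcal{B},\mathcal{P})$ consists of a measurable space $(\mathcal{X},\mathcal{B})$ and a family $\mathcal{P}=\{\mathrm{P}_{\theta}\mid\theta\in\Theta\}$ of probability measures on it, indexed by a parameter $\theta$ in an arbitrary (possibly infinite-dimensional) parameter space $\Theta$. A privileged dominating measure is a probability measure $\mathrm{P}_{0}$ on $(\mathcal{X},\mathcal{B})$ (which may or may not belong to $\mathcal{P}$) such that all $\mathrm{P}_{\theta}$ are absolutely continuous with respect to $\mathrm{P}_{0}$ and, for every $B\in\mathcal{B}$, $\mathrm{P}_{0}(B)=0$ if and only if $\mathrm{P}_{\theta}(B)=0$ for all $\theta\in\Theta$. It is assumed throughout that such a $\mathrm{P}_{0}$ is given. $\mathrm{E}_{0}$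 and $\mathrm{E}_{\theta}$ denote expectation under $\mathrm{P}_{0}$ and $\mathrm{P}_{\theta}$, and $d\mathrm{P}_{\theta}/d\mathrm{P}_{0}$ is the Radon-Nikodym derivative. For a sub-$\sigma$-field $\mathcal{B}_0\subseteq\mathcal{B}$, the restricted subexperiment is $\mathcal{E}_{\mathcal{B}_0}=(\mathcal{X},\mathcal{B}_0,\mathcal{P})$, and $\mathrm{span}$ denotes the set of all (finite, real) linear combinations. $L^1(\mathcal{B}_0,\mathrm{P}_{0})$ is the space of $\mathrm{P}_{0}$-integrable $\mathcal{B}_0$-measurable real-valued functions with norm $\|Y\|_1=\mathrm{E}_{0}(|Y|)$. A random variable $Y$ is (essentially) bounded if there is a constant $0\le M<\infty$ with $\mathrm{P}_{\theta}(|Y|\le M)=1$ for all $\theta\in\Theta$. The $\sigma$-field $\mathcal{B}_0$ (equivalently, $\mathcal{E}_{\mathcal{B}_0}$) is boundedly complete in $\mathcal{E}$ if every $\mathcal{B}_0$-measurable (essentially) bounded real random variable $Y$ such that $\mathrm{E}_{\theta}(Y)=0$ for all $\theta\in\Theta$ is $\mathrm{P}_{\theta}$-a.s. equal to zero for all $\theta\in\Theta$ (equivalently, $\mathrm{P}_{0}$-a.s. equal to zero). *)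

theory Defs
  imports "HOL-Probability.Probability" "HOL-Library.Function_Algebras"
begin

text \<open>
  The argument \<open>X\<close> below only carries a measurable space, that is \<open>space X\<close> and \<open>sets X\<close>; the measure
  stored in it is never used. The same holds for sub-sigma-fields \<open>F\<close>, given by \<open>subalgebra X F\<close>.
\<close>

locale statistical_experiment =
  fixes X :: "'a measure" and \<Theta> :: "'t set" and P :: "'t \<Rightarrow> 'a measure"
  assumes prob_space_P: "\<theta> \<in> \<Theta> \<Longrightarrow> prob_space (P \<theta>)"
    and sets_P: "\<theta> \<in> \<Theta> \<Longrightarrow> sets (P \<theta>) = sets X"

definition privileged_dominating_measure ::
    "'a measure \<Rightarrow> 't set \<Rightarrow> ('t \<Rightarrow> 'a measure) \<Rightarrow> 'a measure \<Rightarrow> bool" where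
  "privileged_dominating_measure X \<Theta> P P0 \<longleftrightarrow>
     prob_space P0 \<and> sets P0 = sets X \<and>
     (\<forall>\<theta>\<in>\<Theta>. absolutely_continuous P0 (P \<theta>)) \<and>
     (\<forall>B\<in>sets X. measure P0 B = 0 \<longleftrightarrow> (\<forall>\<theta>\<in>\<Theta>. measure (P \<theta>) B = 0))"

definition essentially_bounded :: "'t set \<Rightarrow> ('t \<Rightarrow> 'a measure) \<Rightarrow> ('a \<Rightarrow> real) \<Rightarrow> bool" where
  "essentially_bounded \<Theta> P Y \<longleftrightarrow>
     (\<exists>M\<ge>0. \<forall>\<theta>\<in>\<Theta>. measure (P \<theta>) {x \<in> space (P \<theta>). \<bar>Y x\<bar> \<le> M} = 1)"

definition boundedly_complete :: "'t set \<Rightarrow> ('t \<Rightarrow> 'a measure) \<Rightarrow> 'a measure \<Rightarrow> bool" where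
  "boundedly_complete \<Theta> P F \<longleftrightarrow>
     (\<forall>Y \<in> borel_measurable F.
        essentially_bounded \<Theta> P Y \<and> (\<forall>\<theta>\<in>\<Theta>. (\<integral>x. Y x \<partial>P \<theta>) = 0) \<longrightarrow>
        (\<forall>\<theta>\<in>\<Theta>. AE x in P \<theta>. Y x = 0))"

text \<open>
  Elements of \<open>L\<^sup>1\<close> are represented by functions rather than by classes modulo almost sure equality.
  Density only involves the seminorm \<open>E\<^sub>0 |Y|\<close>, which does not depend on the representatives.
\<close>

definition L1_space :: "'a measure \<Rightarrow> 'a measure \<Rightarrow> ('a \<Rightarrow> real) set" where
  "L1_space F P0 = {Y \<in> borel_measurable F. integrable P0 Y}"

definition L1_norm :: "'a measure \<Rightarrow> ('a \<Rightarrow> real) \<Rightarrow> real" where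
  "L1_norm P0 Y = (\<integral>x. \<bar>Y x\<bar> \<partial>P0)"

definition dense_in_L1 :: "'a measure \<Rightarrow> 'a measure \<Rightarrow> ('a \<Rightarrow> real) set \<Rightarrow> bool" where
  "dense_in_L1 F P0 S \<longleftrightarrow>
     S \<subseteq> L1_space F P0 \<and>
     (\<forall>Y \<in> L1_space F P0. \<forall>\<epsilon>>0. \<exists>Z\<in>S. L1_norm P0 (Y - Z) < \<epsilon>)"

definition fun_span :: "('a \<Rightarrow> real) set \<Rightarrow> ('a \<Rightarrow> real) set" where
  "fun_span = module.span (\<lambda>(c::real) f x. c * f x)"

lemma vector_space_fun: "vector_space (\<lambda>(c::real) (f :: 'a \<Rightarrow> real) x. c * f x)"
  by standard (auto simp: fun_eq_iff algebra_simps)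

lemma fun_span_explicit:
  "fun_span S = {(\<lambda>x. \<Sum>f\<in>T. c f * f x) | T c. finite T \<and> T \<subseteq> S}"
proof -
  interpret vector_space "\<lambda>(c::real) (f :: 'a \<Rightarrow> real) x. c * f x"
    by (rule vector_space_fun)
  have "(\<Sum>f\<in>T. (\<lambda>x. c f * f x)) = (\<lambda>x. \<Sum>f\<in>T. c f * f x)"
    for T :: "('a \<Rightarrow> real) set" and c :: "('a \<Rightarrow> real) \<Rightarrow> real"
    by (induction T rule: infinite_finite_induct) (auto simp: fun_eq_iff)
  then show ?thesis
    unfolding fun_span_def span_explicit by simp
qed

text \<open>
  \<open>RN_deriv\<close> takes values in the extended nonnegative reals; under the standing assumptions it is
  almost surely finite, so \<open>enn2real\<close> yields a real-valued version of the density.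
\<close>

definition density_span ::
    "'t set \<Rightarrow> ('t \<Rightarrow> 'a measure) \<Rightarrow> 'a measure \<Rightarrow> 'a measure \<Rightarrow> ('a \<Rightarrow> real) set" where
  "density_span \<Theta> P P0 F =
     fun_span {real_cond_exp P0 F (\<lambda>x. enn2real (RN_deriv P0 (P \<theta>) x)) | \<theta>. \<theta> \<in> \<Theta>}"

end

theory Submission
  imports Defs
begin

text \<open>
  Since \<open>E\<^sub>\<theta> Y = E\<^sub>0 (Y * E\<^sub>0[dP\<^sub>\<theta>/dP\<^sub>0 | B\<^sub>0])\<close> for bounded \<open>B\<^sub>0\<close>-measurable \<open>Y\<close>, bounded completeness
  says that only \<open>0\<close> annihilates the span \<open>S\<close>. The converse direction replaces Hahn-Banach by a
  variational argument. Given \<open>Y\<close>, let \<open>Z\<^sub>n\<close> minimize \<open>E\<^sub>0 \<phi>(Y - Z)\<close> over \<open>S\<close>, where \<open>\<phi>\<close> is the Huber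
  function, a convex function of linear growth that is quadratic near \<open>0\<close>. By convexity the bounded
  functions \<open>\<phi>'(Y - Z\<^sub>n)\<close> form a Cauchy sequence, and the first-order condition makes their limit
  annihilate \<open>S\<close>; hence the limit is \<open>0\<close>. Replacing \<open>Z\<^sub>n\<close> by \<open>(1 - s) Z\<^sub>n\<close> then shows that the
  infimum \<open>m\<close> satisfies \<open>m \<le> (1 - s) m + o(s)\<close>, so \<open>m = 0\<close>, which bounds the \<open>L\<^sup>1\<close> distance as well.
\<close>

section \<open>Pointwise inequalities for the Huber function\<close>

text \<open>\<open>clip\<close> is the derivative of \<open>huber\<close>.\<close>

definition clip :: "real \<Rightarrow> real" where
  "clip t = max (-1) (min 1 t)"

text \<open>This is \<open>t\<^sup>2 / 2\<close> on the interval from -1 to 1 and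
  \<open>\<bar>t\<bar> - 1 / 2\<close> outside. The form through \<open>clip\<close> displays the
  value as \<open>h * t - h\<^sup>2 / 2\<close> at the slope \<open>h = clip t\<close>, so the
  inequalities below need few case splits.\<close>

definition huber :: "real \<Rightarrow> real" where
  "huber t = clip t * t - (clip t)\<^sup>2 / 2"

lemma abs_clip_le_1: "\<bar>clip t\<bar> \<le> 1"
  by (auto simp: clip_def)

lemma clip_of_bounded: "\<bar>t\<bar> \<le> 1 \<Longrightarrow> clip t = t"
  by (auto simp: clip_def)

lemma abs_clip_diff_le: "\<bar>clip a - clip b\<bar> \<le> \<bar>a - b\<bar>"
  by (auto simp: clip_def max_def min_def)

text \<open>The point \<open>s * a\<close> lies between 0 and \<open>a\<close>, and
  \<open>clip\<close> is monotone and vanishes at 0.\<close>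

lemma abs_clip_mult_le:
  assumes s: "0 \<le> s" "s \<le> 1"
  shows "\<bar>clip (s * a)\<bar> \<le> \<bar>clip a\<bar>"
proof -
  have 1: "0 \<le> a \<Longrightarrow> 0 \<le> s * a \<and> s * a \<le> a"
    using s by (simp add: mult_left_le_one_le)
  have 2: "a \<le> 0 \<Longrightarrow> s * a \<le> 0 \<and> a \<le> s * a"
    using s mult_left_le_one_le[of "-a" s] by (auto simp: mult_nonneg_nonpos)
  define b where "b = s * a"
  show ?thesis
    using 1 2 unfolding b_def[symmetric]
    by (cases "0 \<le> a") (auto simp: clip_def max_def min_def)
qed

lemma continuous_clip: "continuous_on UNIV clip"
  unfolding clip_def by (intro continuous_intros)

lemma borel_measurable_clip [measurable]: "clip \<in> borel_measurable borel"
  by (intro borel_measurable_continuous_onI continuous_clip)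

lemma borel_measurable_huber [measurable]: "huber \<in> borel_measurable borel"
  unfolding huber_def by measurable

text \<open>The function \<open>huber\<close> is the supremum of \<open>\<lambda>a. h * a - h\<^sup>2 / 2\<close> over \<open>\<bar>h\<bar> \<le> 1\<close>, attained at
  \<open>clip a\<close>; the square on the right is the strong concavity in \<open>h\<close>.\<close>

lemma huber_ge:
  assumes "\<bar>h\<bar> \<le> 1"
  shows "h * a - h\<^sup>2 / 2 + (clip a - h)\<^sup>2 / 2 \<le> huber a"
proof -
  \<comment> \<open>\<open>clip a\<close> is the projection of \<open>a\<close> onto the interval
    from -1 to 1; this is its variational inequality.\<close>
  have "0 \<le> (clip a - h) * (a - clip a)"
    using assms by (cases "a > 1"; cases "a < -1")
      (auto simp: clip_def max_def min_def mult_nonpos_nonpos)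
  then show ?thesis
    by (simp add: huber_def power2_eq_square field_simps)
qed

lemma huber_nonneg: "0 \<le> huber a"
proof -
  have "0 \<le> 0 * a - 0\<^sup>2 / 2 + (clip a - 0)\<^sup>2 / 2" by simp
  also have "\<dots> \<le> huber a" by (rule huber_ge) simp
  finally show ?thesis .
qed

lemma huber_le_abs: "huber a \<le> \<bar>a\<bar>"
proof -
  have "clip a * a \<le> \<bar>clip a\<bar> * \<bar>a\<bar>"
    by (metis abs_ge_self abs_mult)
  also have "\<dots> \<le> \<bar>a\<bar>"
    by (simp add: abs_clip_le_1 mult_left_le_one_le)
  finally have "clip a * a \<le> \<bar>a\<bar>" .
  moreover have "huber a \<le> clip a * a"
    by (simp add: huber_def)
  ultimately show ?thesis by simp
qed

text \<open>Both values on the right are bounded below by \<open>huber_ge\<close> with the slope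
  that is optimal at the midpoint. The quadratic gain will make the derivatives along a minimizing
  sequence Cauchy.\<close>

lemma huber_midpoint:
  "2 * huber ((a + b) / 2) + (clip a - clip b)\<^sup>2 / 4 \<le> huber a + huber b"
proof -
  define h where "h = clip ((a + b) / 2)"
  have h: "\<bar>h\<bar> \<le> 1" by (simp add: h_def abs_clip_le_1)
  \<comment> \<open>Parallelogram identity, with the square of
    \<open>clip a + clip b - 2 * h\<close> dropped.\<close>
  have "(clip a - clip b)\<^sup>2 / 4 \<le> (clip a - h)\<^sup>2 / 2 + (clip b - h)\<^sup>2 / 2"
    using zero_le_power2[of "clip a + clip b - 2 * h"]
    by (simp add: power2_eq_square field_simps)
  moreover have "2 * huber ((a + b) / 2) = (h * a - h\<^sup>2 / 2) + (h * b - h\<^sup>2 / 2)"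
    unfolding huber_def h_def[symmetric] by (simp add: algebra_simps)
  ultimately show ?thesis
    using huber_ge[OF h, of a] huber_ge[OF h, of b] by linarith
qed

text \<open>First-order expansion: the slope optimal at \<open>a + b\<close> is tested at
  \<open>a\<close>, and it differs from \<open>clip a\<close> by at most
  \<open>\<bar>b\<bar>\<close> and by at most 2. The linear bound makes the remainder integrable for
  integrable \<open>b\<close>; the quadratic one makes it of smaller order under scaling.\<close>

lemma huber_add_le:
  "huber (a + b) \<le> huber a + clip a * b + min (b\<^sup>2) (2 * \<bar>b\<bar>)"
proof -
  define h where "h = clip (a + b)"
  have h: "\<bar>h\<bar> \<le> 1" by (simp add: h_def abs_clip_le_1)
  have "(h - clip a) * b \<le> \<bar>h - clip a\<bar> * \<bar>b\<bar>"
    by (metis abs_ge_self abs_mult)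
  moreover have "\<bar>h - clip a\<bar> * \<bar>b\<bar> \<le> \<bar>b\<bar> * \<bar>b\<bar>"
    using abs_clip_diff_le[of "a + b" a] by (intro mult_right_mono) (auto simp: h_def)
  moreover have "\<bar>h - clip a\<bar> * \<bar>b\<bar> \<le> 2 * \<bar>b\<bar>"
    using h abs_clip_le_1[of a] by (intro mult_right_mono) linarith+
  ultimately have "(h - clip a) * b \<le> min (b\<^sup>2) (2 * \<bar>b\<bar>)"
    by (simp add: power2_eq_square)
  moreover have "huber (a + b) = (h * a - h\<^sup>2 / 2) + h * b"
    by (simp add: huber_def h_def[symmetric] algebra_simps)
  moreover have "0 \<le> (clip a - h)\<^sup>2 / 2" by simp
  moreover have "(h - clip a) * b = h * b - clip a * b"
    by (simp add: left_diff_distrib)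
  ultimately show ?thesis
    using huber_ge[OF h, of a] by linarith
qed

text \<open>Convexity together with the value 0 at 0; concretely, the slope optimal at
  \<open>s * a\<close> is tested at \<open>a\<close>.\<close>

lemma huber_mult_le:
  assumes "0 \<le> s" "s \<le> 1"
  shows "huber (s * a) \<le> s * huber a"
proof -
  define h where "h = clip (s * a)"
  have h: "\<bar>h\<bar> \<le> 1" by (simp add: h_def abs_clip_le_1)
  have "huber (s * a) = s * (h * a - h\<^sup>2 / 2) - (1 - s) * (h\<^sup>2 / 2)"
    unfolding huber_def h_def[symmetric] by (simp add: field_simps)
  also have "\<dots> \<le> s * (h * a - h\<^sup>2 / 2)"
    using assms by simp
  also have "\<dots> \<le> s * huber a"
    using order_trans[OF _ huber_ge[OF h, of a]] assms
    by (intro mult_left_mono) auto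
  finally show ?thesis .
qed

text \<open>Near 0 the Huber function is quadratic and no multiple of it dominates
  \<open>\<bar>t\<bar>\<close>, hence the additive \<open>e\<close>. Integrated, this turns a small
  Huber integral into a small \<open>L\<^sup>1\<close> seminorm.\<close>

lemma abs_le_huber:
  assumes "0 < e"
  shows "\<bar>t\<bar> \<le> e + (2 + 1 / (2 * e)) * huber t"
proof (cases "\<bar>t\<bar> \<le> 1")
  case True
  \<comment> \<open>Completing the square gives
    \<open>\<bar>t\<bar> \<le> e + t\<^sup>2 / (4 * e)\<close>.\<close>
  have "0 \<le> (\<bar>t\<bar> - 2 * e)\<^sup>2 / (4 * e)" using assms by simp
  also have "\<dots> = e - \<bar>t\<bar> + 1 / (2 * e) * (t\<^sup>2 / 2)"
    using assms by (simp add: power2_eq_square field_simps)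
  also have "t\<^sup>2 / 2 = huber t"
    using True by (simp add: huber_def clip_of_bounded power2_eq_square)
  finally show ?thesis
    using huber_nonneg[of t] by (simp add: algebra_simps)
next
  case False
  then have "t > 1 \<or> t < -1" by auto
  then have "huber t = \<bar>t\<bar> - 1 / 2"
    by (auto simp: huber_def clip_def max_def min_def)
  then have "\<bar>t\<bar> \<le> 2 * huber t" using False by simp
  moreover have "0 \<le> 1 / (2 * e) * huber t"
    using assms huber_nonneg[of t] by simp
  ultimately show ?thesis
    using assms unfolding distrib_right by linarith
qed


section \<open>Integrability and the order of the remainder\<close>

lemma integrable_huber:
  assumes f: "integrable M f"
  shows "integrable M (\<lambda>x. huber (f x))"
proof (rule Bochner_Integration.integrable_bound[OF f])
  show "(\<lambda>x. huber (f x)) \<in> borel_measurable M"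
    using borel_measurable_integrable[OF f] by measurable
  show "AE x in M. norm (huber (f x)) \<le> norm (f x)"
    by (intro AE_I2) (simp add: huber_nonneg huber_le_abs)
qed

lemma integrable_mult_bounded:
  fixes f g :: "'a \<Rightarrow> real"
  assumes f: "integrable M f" and g: "g \<in> borel_measurable M" and K: "AE x in M. \<bar>g x\<bar> \<le> K"
  shows "integrable M (\<lambda>x. g x * f x)"
proof (rule Bochner_Integration.integrable_bound)
  show "integrable M (\<lambda>x. K * f x)" using f by simp
  show "(\<lambda>x. g x * f x) \<in> borel_measurable M"
    using g borel_measurable_integrable[OF f] by measurable
  show "AE x in M. norm (g x * f x) \<le> norm (K * f x)"
    using K
  proof eventually_elim
    case (elim x)
    then have "\<bar>g x\<bar> \<le> \<bar>K\<bar>" by linarith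
    then show ?case by (simp add: abs_mult mult_right_mono)
  qed
qed

lemma integrable_clip_mult:
  assumes f: "integrable M f" and g: "g \<in> borel_measurable M"
  shows "integrable M (\<lambda>x. clip (g x) * f x)"
proof (rule integrable_mult_bounded[OF f])
  show "(\<lambda>x. clip (g x)) \<in> borel_measurable M" using g by measurable
  show "AE x in M. \<bar>clip (g x)\<bar> \<le> 1" by (intro AE_I2 abs_clip_le_1)
qed

lemma integrable_min_square_abs:
  fixes f :: "'a \<Rightarrow> real"
  assumes f: "integrable M f"
  shows "integrable M (\<lambda>x. min ((f x)\<^sup>2) (2 * \<bar>f x\<bar>))"
proof (rule Bochner_Integration.integrable_bound)
  show "integrable M (\<lambda>x. 2 * f x)" using f by simp
  show "(\<lambda>x. min ((f x)\<^sup>2) (2 * \<bar>f x\<bar>)) \<in> borel_measurable M"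
    using borel_measurable_integrable[OF f] by measurable
  have "\<bar>min ((f x)\<^sup>2) (2 * \<bar>f x\<bar>)\<bar> \<le> 2 * \<bar>f x\<bar>" for x
    by (subst abs_of_nonneg) auto
  then show "AE x in M. norm (min ((f x)\<^sup>2) (2 * \<bar>f x\<bar>)) \<le> norm (2 * f x)"
    by (intro AE_I2) (simp add: abs_mult)
qed

text \<open>Taking out one factor \<open>s\<close> leaves
  \<open>min (s * (f x)\<^sup>2) (2 * \<bar>f x\<bar>)\<close>. Although \<open>f\<close> need not
  be square integrable, the second argument dominates, so the integral of this minimum tends to 0
  with \<open>s\<close>.\<close>

lemma integral_min_square_abs_small:
  fixes f :: "'a \<Rightarrow> real"
  assumes f: "integrable M f" and e: "0 < e"
  obtains s where "0 < s" "s \<le> 1"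
    "(\<integral>x. min ((s * f x)\<^sup>2) (2 * \<bar>s * f x\<bar>) \<partial>M) \<le> e * s"
proof -
  have [measurable]: "f \<in> borel_measurable M" using f by auto
  have "(\<lambda>k. \<integral>x. min (inverse (real (Suc k)) * (f x)\<^sup>2) (2 * \<bar>f x\<bar>) \<partial>M)
      \<longlonglongrightarrow> (\<integral>x. 0 \<partial>M)"
  proof (rule integral_dominated_convergence[where w = "\<lambda>x. 2 * \<bar>f x\<bar>"])
    have "(\<lambda>k. min (inverse (real (Suc k)) * (f x)\<^sup>2) (2 * \<bar>f x\<bar>))
        \<longlonglongrightarrow> min (0 * (f x)\<^sup>2) (2 * \<bar>f x\<bar>)" for x
      by (intro tendsto_intros LIMSEQ_inverse_real_of_nat)
    then show "AE x in M. (\<lambda>k. min (inverse (real (Suc k)) * (f x)\<^sup>2) (2 * \<bar>f x\<bar>)) \<longlonglongrightarrow> 0"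
      by simp
    show "AE x in M. norm (min (inverse (real (Suc k)) * (f x)\<^sup>2) (2 * \<bar>f x\<bar>)) \<le> 2 * \<bar>f x\<bar>" for k
      by (auto simp: min_def)
  qed (use f in auto)
  then have "\<forall>\<^sub>F k in sequentially.
      (\<integral>x. min (inverse (real (Suc k)) * (f x)\<^sup>2) (2 * \<bar>f x\<bar>) \<partial>M) < e"
    using e by (intro order_tendstoD(2)[where a = e]) auto
  then obtain k where k: "(\<integral>x. min (inverse (real (Suc k)) * (f x)\<^sup>2) (2 * \<bar>f x\<bar>) \<partial>M) < e"
    using eventually_happens'[OF sequentially_bot] by blast
  define s where "s = inverse (real (Suc k))"
  have s: "0 < s" "s \<le> 1" by (simp_all add: s_def inverse_le_1_iff)
  have "min ((s * f x)\<^sup>2) (2 * \<bar>s * f x\<bar>) = s * min (s * (f x)\<^sup>2) (2 * \<bar>f x\<bar>)" for x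
  proof -
    have "s * min (s * (f x)\<^sup>2) (2 * \<bar>f x\<bar>) = min (s * (s * (f x)\<^sup>2)) (s * (2 * \<bar>f x\<bar>))"
      using s by (simp add: min_mult_distrib_left)
    then show ?thesis using s by (simp add: abs_mult power2_eq_square ac_simps)
  qed
  then have "(\<integral>x. min ((s * f x)\<^sup>2) (2 * \<bar>s * f x\<bar>) \<partial>M)
      = s * (\<integral>x. min (s * (f x)\<^sup>2) (2 * \<bar>f x\<bar>) \<partial>M)"
    by simp
  also have "\<dots> \<le> s * e"
    using k s by (intro mult_left_mono) (auto simp: s_def)
  finally show ?thesis using that s by (simp add: mult.commute)
qed

section \<open>Density forces bounded annihilators to vanish\<close>

text \<open>Pair \<open>Y\<close> with itself: by orthogonality, subtracting an approximant
  \<open>Z\<close> from one factor changes nothing, so the integral of \<open>Y x * Y x\<close> is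
  at most \<open>\<bar>K\<bar>\<close> times the distance from \<open>Y\<close> to
  \<open>Z\<close>.\<close>

lemma (in finite_measure) dense_in_L1_annihilator_trivial:
  assumes sub: "subalgebra M F" and dense: "dense_in_L1 F M S"
    and Y: "Y \<in> borel_measurable F" "AE x in M. \<bar>Y x\<bar> \<le> K"
    and orth: "\<And>W. W \<in> S \<Longrightarrow> (\<integral>x. Y x * W x \<partial>M) = 0"
  shows "AE x in M. Y x = 0"
proof -
  have Ym [measurable]: "Y \<in> borel_measurable M"
    using measurable_from_subalg[OF sub Y(1)] .
  have Yi: "integrable M Y"
    using Y(2) by (intro integrable_const_bound[where B = K]) auto
  have mult: "integrable M (\<lambda>x. Y x * f x)" if "integrable M f" for f
    using integrable_mult_bounded[OF that Ym Y(2)] .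
  have "(\<integral>x. Y x * Y x \<partial>M) \<le> 0"
  proof (rule field_le_epsilon)
    fix e :: real assume e: "0 < e"
    \<comment> \<open>The added 1 keeps the denominator positive even for
      \<open>K = 0\<close>.\<close>
    define d where "d = e / (\<bar>K\<bar> + 1)"
    have d: "0 < d" "\<bar>K\<bar> * d \<le> e" using e by (auto simp: d_def field_simps)
    obtain Z where Z: "Z \<in> S" "L1_norm M (Y - Z) < d"
      using dense d Y(1) Yi unfolding dense_in_L1_def L1_space_def by blast
    have Zi: "integrable M Z"
      using dense Z(1) by (auto simp: dense_in_L1_def L1_space_def)
    have "(\<integral>x. Y x * Y x \<partial>M) = (\<integral>x. Y x * (Y x - Z x) \<partial>M)"
      using orth[OF Z(1)] mult[OF Yi] mult[OF Zi] by (simp add: right_diff_distrib)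
    also have "\<dots> \<le> (\<integral>x. \<bar>K\<bar> * \<bar>Y x - Z x\<bar> \<partial>M)"
    proof (rule integral_mono_AE)
      show "AE x in M. Y x * (Y x - Z x) \<le> \<bar>K\<bar> * \<bar>Y x - Z x\<bar>"
        using Y(2)
      proof eventually_elim
        case (elim x)
        have "Y x * (Y x - Z x) \<le> \<bar>Y x\<bar> * \<bar>Y x - Z x\<bar>"
          by (metis abs_ge_self abs_mult)
        also have "\<dots> \<le> \<bar>K\<bar> * \<bar>Y x - Z x\<bar>"
          using elim by (intro mult_right_mono) auto
        finally show ?case .
      qed
    qed (use mult Yi Zi in auto)
    also have "\<dots> = \<bar>K\<bar> * L1_norm M (Y - Z)"
      by (simp add: L1_norm_def)
    also have "\<dots> \<le> \<bar>K\<bar> * d"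
      using Z(2) by (intro mult_left_mono) auto
    finally show "(\<integral>x. Y x * Y x \<partial>M) \<le> 0 + e" using d by simp
  qed
  then have "(\<integral>x. Y x * Y x \<partial>M) = 0"
    by (simp add: order_antisym)
  then have "AE x in M. Y x * Y x = 0"
    using integral_nonneg_eq_0_iff_AE[OF mult[OF Yi]] by simp
  then show ?thesis by simp
qed

section \<open>From trivial annihilators to density\<close>

text \<open>The annihilator to be tested arises as a limit of functions \<open>clip (u n x)\<close>,
  so triviality is assumed only for \<open>F\<close>-measurable functions bounded by 1
  everywhere.\<close>

lemma (in finite_measure) dense_in_L1I:
  assumes sub: "subalgebra M F" and S: "S \<subseteq> L1_space F M"
    and ne: "S \<noteq> {}"
    and add: "\<And>f g. f \<in> S \<Longrightarrow> g \<in> S \<Longrightarrow> (\<lambda>x. f x + g x) \<in> S"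
    and scale: "\<And>c f. f \<in> S \<Longrightarrow> (\<lambda>x. c * f x) \<in> S"
    and annihilator_trivial:
      "\<And>g. g \<in> borel_measurable F \<Longrightarrow> (\<And>x. \<bar>g x\<bar> \<le> 1) \<Longrightarrow>
        (\<And>W. W \<in> S \<Longrightarrow> (\<integral>x. g x * W x \<partial>M) = 0) \<Longrightarrow> AE x in M. g x = 0"
  shows "dense_in_L1 F M S"
  unfolding dense_in_L1_def
proof (intro conjI S ballI allI impI)
  fix Y and \<epsilon> :: real
  assume Y: "Y \<in> L1_space F M" and \<epsilon>: "0 < \<epsilon>"
  \<comment> \<open>\<open>J\<close> is the convex objective, finite on integrable functions by
    linear growth; \<open>R\<close> is the integrated remainder of
    \<open>huber_add_le\<close>.\<close>
  define J where "J u = (\<integral>x. huber (u x) \<partial>M)" for u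
  define m where "m = (INF Z\<in>S. J (\<lambda>x. Y x - Z x))"
  define R where "R b = (\<integral>x. min ((b x)\<^sup>2) (2 * \<bar>b x\<bar>) \<partial>M)" for b :: "'a \<Rightarrow> real"
  have YF [measurable]: "Y \<in> borel_measurable F" and Yi: "integrable M Y"
    using Y by (auto simp: L1_space_def)
  have Si: "integrable M W" and SF: "W \<in> borel_measurable F" if "W \<in> S" for W
    using S that by (auto simp: L1_space_def)
  have bdd: "bdd_below ((\<lambda>Z. J (\<lambda>x. Y x - Z x)) ` S)"
    by (auto simp: J_def huber_nonneg intro!: bdd_belowI[of _ 0])
  have m_le: "m \<le> J (\<lambda>x. Y x - Z x)" if "Z \<in> S" for Z
    unfolding m_def by (rule cINF_lower[OF bdd that])
  have near: "\<exists>Z\<in>S. J (\<lambda>x. Y x - Z x) < m + e" if "0 < e" for e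
    using cINF_less_iff[OF ne bdd, of "m + e"] that unfolding m_def[symmetric] by auto
  \<comment> \<open>The middle term is the directional derivative of \<open>J\<close> at
    \<open>u\<close> along \<open>b\<close>.\<close>
  have J_add_le: "J (\<lambda>x. u x + b x) \<le> J u + (\<integral>x. clip (u x) * b x \<partial>M) + R b"
    if u: "integrable M u" and b: "integrable M b" for u b
  proof -
    have um: "u \<in> borel_measurable M" using u by auto
    note i = integrable_huber[OF u] integrable_clip_mult[OF b um] integrable_min_square_abs[OF b]
    have "J (\<lambda>x. u x + b x)
        \<le> (\<integral>x. huber (u x) + clip (u x) * b x + min ((b x)\<^sup>2) (2 * \<bar>b x\<bar>) \<partial>M)"
      unfolding J_def
      by (intro integral_mono huber_add_le integrable_huber Bochner_Integration.integrable_add i u b)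
    also have "\<dots> = J u + (\<integral>x. clip (u x) * b x \<partial>M) + R b"
      unfolding J_def R_def using i by simp
    finally show ?thesis .
  qed

  have "\<exists>Z. \<forall>n. Z n \<in> S \<and> J (\<lambda>x. Y x - Z n x) < m + inverse (real (Suc n))"
    using near[of "inverse (real (Suc n))" for n] by (intro choice) (simp add: Bex_def)
  then obtain Z where ZS: "\<And>n. Z n \<in> S"
    and ZJ: "\<And>n. J (\<lambda>x. Y x - Z n x) < m + inverse (real (Suc n))"
    by auto
  define u where "u n x = Y x - Z n x" for n x
  have Jm: "m \<le> J (u n)" "J (u n) < m + inverse (real (Suc n))" for n
    using m_le[OF ZS] ZJ unfolding u_def by auto
  have ui: "integrable M (u n)" for n
    unfolding u_def using Yi Si[OF ZS] by auto
  have uF [measurable]: "u n \<in> borel_measurable F" for n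
    unfolding u_def using SF[OF ZS] by measurable
  have uM [measurable]: "u n \<in> borel_measurable M" for n
    using ui by auto
  have clip_i: "integrable M (\<lambda>x. clip (u n x))" for n
    by (rule integrable_const_bound[where B = 1]) (auto simp: abs_clip_le_1)

  \<comment> \<open>The midpoint of \<open>Z i\<close> and \<open>Z j\<close> lies in
    \<open>S\<close>, so its objective is at least \<open>m\<close>; the excesses of
    \<open>J (u i)\<close> and \<open>J (u j)\<close> over \<open>m\<close> then bound the quadratic
    gain in \<open>huber_midpoint\<close>.\<close>
  have gap: "(\<integral>x. (clip (u i x) - clip (u j x))\<^sup>2 \<partial>M)
      \<le> 4 * (inverse (real (Suc i)) + inverse (real (Suc j)))" for i j
  proof -
    have "(\<lambda>x. (1 / 2) * Z i x + (1 / 2) * Z j x) \<in> S"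
      by (intro add scale ZS)
    then have "m \<le> J (\<lambda>x. Y x - ((1 / 2) * Z i x + (1 / 2) * Z j x))"
      by (rule m_le)
    also have "(\<lambda>x. Y x - ((1 / 2) * Z i x + (1 / 2) * Z j x)) = (\<lambda>x. (u i x + u j x) / 2)"
      by (auto simp: u_def fun_eq_iff field_simps)
    finally have mid: "m \<le> J (\<lambda>x. (u i x + u j x) / 2)" .
    have sq: "integrable M (\<lambda>x. (clip (u i x) - clip (u j x))\<^sup>2)"
    proof (rule integrable_const_bound[where B = 4])
      have "(clip (u i x) - clip (u j x))\<^sup>2 \<le> 2\<^sup>2" for x
        using abs_clip_le_1[of "u i x"] abs_clip_le_1[of "u j x"]
        by (intro abs_le_square_iff[THEN iffD1]) auto
      then show "AE x in M. norm ((clip (u i x) - clip (u j x))\<^sup>2) \<le> 4" by simp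
    qed measurable
    have im: "integrable M (\<lambda>x. huber ((u i x + u j x) / 2))"
      by (rule integrable_huber) (use ui in auto)
    have "2 * J (\<lambda>x. (u i x + u j x) / 2) + (\<integral>x. (clip (u i x) - clip (u j x))\<^sup>2 \<partial>M) / 4
        = (\<integral>x. 2 * huber ((u i x + u j x) / 2) + (clip (u i x) - clip (u j x))\<^sup>2 / 4 \<partial>M)"
      unfolding J_def using im sq by simp
    also have "\<dots> \<le> (\<integral>x. huber (u i x) + huber (u j x) \<partial>M)"
      by (rule integral_mono) (use im sq integrable_huber[OF ui] huber_midpoint in auto)
    also have "\<dots> = J (u i) + J (u j)"
      unfolding J_def using integrable_huber[OF ui] by simp
    finally show ?thesis
      unfolding distrib_left using mid Jm(2)[of i] Jm(2)[of j] by linarith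
  qed

  \<comment> \<open>A bound on squares becomes an \<open>L\<^sup>1\<close> bound through
    \<open>\<bar>D x\<bar> \<le> h + (D x)\<^sup>2 / (4 * h)\<close>. With \<open>h\<close> as below
    the first term contributes less than \<open>e / 2\<close>, and the threshold
    \<open>h * e / 8\<close> keeps the second below \<open>e / 4\<close>.\<close>
  have cauchy: "\<exists>N. \<forall>i\<ge>N. \<forall>j\<ge>N. (\<integral>x. norm (clip (u i x) - clip (u j x)) \<partial>M) < e"
    if e: "0 < e" for e
  proof -
    define \<mu> where "\<mu> = measure M (space M)"
    define h where "h = e / (2 * (\<mu> + 1))"
    have \<mu>: "0 \<le> \<mu>" by (simp add: \<mu>_def)
    then have h: "0 < h" "h * \<mu> < e / 2" using e by (auto simp: h_def field_simps)
    obtain N where N: "inverse (real (Suc N)) < h * e / 8"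
      using reals_Archimedean[of "h * e / 8"] h e by auto
    show ?thesis
    proof (intro exI allI impI)
      fix i j assume ij: "N \<le> i" "N \<le> j"
      have small: "inverse (real (Suc k)) < h * e / 8" if "N \<le> k" for k
        using that N by (intro le_less_trans[OF _ N] le_imp_inverse_le) auto
      define D where "D x = clip (u i x) - clip (u j x)" for x
      have Di: "integrable M D" unfolding D_def using clip_i by simp
      have D2: "integrable M (\<lambda>x. (D x)\<^sup>2)"
      proof (rule integrable_const_bound[where B = 4])
        have "(D x)\<^sup>2 \<le> 2\<^sup>2" for x
          using abs_clip_le_1[of "u i x"] abs_clip_le_1[of "u j x"]
          by (intro abs_le_square_iff[THEN iffD1]) (auto simp: D_def)
        then show "AE x in M. norm ((D x)\<^sup>2) \<le> 4" by simp
      qed (use Di in measurable)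
      have *: "norm (D x) \<le> h + (D x)\<^sup>2 / (4 * h)" for x
      proof -
        have "0 \<le> (\<bar>D x\<bar> - 2 * h)\<^sup>2 / (4 * h)" using h by simp
        also have "\<dots> = h - \<bar>D x\<bar> + (D x)\<^sup>2 / (4 * h)"
          using h by (simp add: power2_eq_square field_simps)
        finally show ?thesis by simp
      qed
      have "(\<integral>x. norm (D x) \<partial>M) \<le> (\<integral>x. h + (D x)\<^sup>2 / (4 * h) \<partial>M)"
        by (rule integral_mono) (use Di D2 * in auto)
      also have "\<dots> = h * \<mu> + (\<integral>x. (D x)\<^sup>2 \<partial>M) / (4 * h)"
        using D2 by (simp add: \<mu>_def mult.commute)
      also have "\<dots> \<le> h * \<mu> + (4 * (inverse (real (Suc i)) + inverse (real (Suc j)))) / (4 * h)"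
        using gap[of i j] h by (intro add_left_mono divide_right_mono) (auto simp: D_def)
      also have "\<dots> < e / 2 + (4 * (h * e / 8 + h * e / 8)) / (4 * h)"
        using h small[OF ij(1)] small[OF ij(2)]
        by (intro add_strict_mono divide_strict_right_mono mult_strict_left_mono) auto
      also have "\<dots> \<le> e" using h e by (simp add: field_simps)
      finally show "(\<integral>x. norm (clip (u i x) - clip (u j x)) \<partial>M) < e"
        by (simp add: D_def)
    qed
  qed
  obtain r where r: "strict_mono r" and r_cauchy: "AE x in M. Cauchy (\<lambda>i. clip (u (r i) x))"
    using cauchy_L1_AE_cauchy_subseq[of M "\<lambda>n x. clip (u n x)"] clip_i cauchy by auto

  \<comment> \<open>The outer \<open>clip\<close> bounds \<open>g\<close> by 1 also where the
    sequence diverges and \<open>lim\<close> is unspecified; at points of convergence it does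
    nothing.\<close>
  define g where "g x = clip (lim (\<lambda>i. clip (u (r i) x)))" for x
  have gF: "g \<in> borel_measurable F"
    unfolding g_def by measurable
  have gM [measurable]: "g \<in> borel_measurable M"
    by (rule measurable_from_subalg[OF sub gF])
  have g_lim: "AE x in M. (\<lambda>i. clip (u (r i) x)) \<longlonglongrightarrow> g x"
    using r_cauchy
  proof eventually_elim
    case (elim x)
    then have l: "(\<lambda>i. clip (u (r i) x)) \<longlonglongrightarrow> lim (\<lambda>i. clip (u (r i) x))"
      by (simp add: Cauchy_convergent_iff convergent_LIMSEQ_iff)
    have "\<bar>lim (\<lambda>i. clip (u (r i) x))\<bar> \<le> 1"
      by (rule Lim_bounded[OF tendsto_rabs[OF l], of 0]) (simp add: abs_clip_le_1)
    then show ?case using l by (simp add: g_def clip_of_bounded)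
  qed
  have g_le: "\<bar>g x\<bar> \<le> 1" for x by (simp add: g_def abs_clip_le_1)

  have J_lim: "(\<lambda>n. J (u (r n))) \<longlonglongrightarrow> m"
  proof (rule LIMSEQ_subseq_LIMSEQ[OF _ r, unfolded o_def])
    show "(\<lambda>n. J (u n)) \<longlonglongrightarrow> m"
    proof (rule tendsto_sandwich[where f = "\<lambda>_. m"])
      show "(\<lambda>n. m + inverse (real (Suc n))) \<longlonglongrightarrow> m"
        using tendsto_add[OF tendsto_const[of m] LIMSEQ_inverse_real_of_nat] by simp
      show "\<forall>\<^sub>F n in sequentially. m \<le> J (u n)"
        by (intro always_eventually allI Jm)
      show "\<forall>\<^sub>F n in sequentially. J (u n) \<le> m + inverse (real (Suc n))"
        by (intro always_eventually allI less_imp_le Jm)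
    qed simp
  qed

  have g_orth_le: "(\<integral>x. g x * W x \<partial>M) \<le> 0" if W: "W \<in> S" for W
  proof (rule field_le_epsilon)
    fix e :: real assume "0 < e"
    then obtain s where s: "0 < s" "s \<le> 1" and Rs: "R (\<lambda>x. s * W x) \<le> e * s"
      unfolding R_def by (rule integral_min_square_abs_small[OF Si[OF W]])
    \<comment> \<open>The competitor is \<open>Z n + s * W\<close>. Since \<open>Z n\<close> is only
      nearly optimal, the excess \<open>J (u n) - m\<close> remains; along the subsequence it
      vanishes with \<open>s\<close> fixed, after which \<open>s\<close> is divided out.\<close>
    have step: "s * (\<integral>x. clip (u n x) * W x \<partial>M) \<le> J (u n) - m + e * s" for n
    proof -
      have "(\<lambda>x. Z n x + s * W x) \<in> S" by (intro add scale ZS W)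
      then have "m \<le> J (\<lambda>x. u n x + - (s * W x))"
        using m_le[of "\<lambda>x. Z n x + s * W x"] by (simp add: u_def algebra_simps)
      also have "\<dots> \<le> J (u n) + (\<integral>x. clip (u n x) * - (s * W x) \<partial>M) + R (\<lambda>x. - (s * W x))"
        by (rule J_add_le) (use ui Si[OF W] in auto)
      also have "(\<integral>x. clip (u n x) * - (s * W x) \<partial>M) = - s * (\<integral>x. clip (u n x) * W x \<partial>M)"
        by (simp flip: integral_mult_right_zero add: ac_simps)
      also have "R (\<lambda>x. - (s * W x)) = R (\<lambda>x. s * W x)" by (simp add: R_def)
      finally show ?thesis using Rs by simp
    qed
    have "(\<lambda>n. \<integral>x. clip (u (r n) x) * W x \<partial>M) \<longlonglongrightarrow> (\<integral>x. g x * W x \<partial>M)"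
    proof (rule integral_dominated_convergence[where w = "\<lambda>x. \<bar>W x\<bar>"])
      show "AE x in M. (\<lambda>n. clip (u (r n) x) * W x) \<longlonglongrightarrow> g x * W x"
        using g_lim by eventually_elim (intro tendsto_intros)
      show "AE x in M. norm (clip (u (r n) x) * W x) \<le> \<bar>W x\<bar>" for n
        by (simp add: abs_mult abs_clip_le_1 mult_left_le_one_le)
    qed (use Si[OF W] in auto)
    then have "(\<lambda>n. s * (\<integral>x. clip (u (r n) x) * W x \<partial>M)) \<longlonglongrightarrow> s * (\<integral>x. g x * W x \<partial>M)"
      by (intro tendsto_intros)
    moreover have "(\<lambda>n. J (u (r n)) - m + e * s) \<longlonglongrightarrow> m - m + e * s"
      by (intro tendsto_intros J_lim)
    ultimately have "s * (\<integral>x. g x * W x \<partial>M) \<le> m - m + e * s"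
      by (rule LIMSEQ_le) (use step in blast)
    then show "(\<integral>x. g x * W x \<partial>M) \<le> 0 + e" using s by simp
  qed
  have "AE x in M. g x = 0"
  proof (rule annihilator_trivial[OF gF g_le])
    fix W assume W: "W \<in> S"
    have "(\<lambda>x. - W x) \<in> S" using scale[OF W, of "-1"] by simp
    from g_orth_le[OF this] g_orth_le[OF W] show "(\<integral>x. g x * W x \<partial>M) = 0" by simp
  qed
  with g_lim have clip_lim: "AE x in M. (\<lambda>i. clip (u (r i) x)) \<longlonglongrightarrow> 0"
    by eventually_elim simp

  \<comment> \<open>Shrinking \<open>Z n\<close> by the factor \<open>1 - s\<close> turns the
    residual into \<open>(1 - s) * u n x + s * Y x\<close>. Convexity scales the main term by
    \<open>1 - s\<close>, and the derivative term vanishes in the limit because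
    \<open>clip (u (r n) x)\<close> tends to 0; what is left is
    \<open>s * m \<le> s * e\<close>.\<close>
  have "m \<le> 0"
  proof (rule field_le_epsilon)
    fix e :: real assume "0 < e"
    then obtain s where s: "0 < s" "s \<le> 1" and Rs: "R (\<lambda>x. s * Y x) \<le> e * s"
      unfolding R_def by (rule integral_min_square_abs_small[OF Yi])
    have step: "m \<le> (1 - s) * J (u n) + s * (\<integral>x. \<bar>clip (u n x)\<bar> * \<bar>Y x\<bar> \<partial>M) + e * s" for n
    proof -
      have "m \<le> J (\<lambda>x. Y x - (1 - s) * Z n x)"
        by (rule m_le[OF scale[OF ZS]])
      also have "(\<lambda>x. Y x - (1 - s) * Z n x) = (\<lambda>x. (1 - s) * u n x + s * Y x)"
        by (auto simp: u_def fun_eq_iff algebra_simps)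
      also have "J \<dots> \<le> J (\<lambda>x. (1 - s) * u n x)
          + (\<integral>x. clip ((1 - s) * u n x) * (s * Y x) \<partial>M) + R (\<lambda>x. s * Y x)"
        by (rule J_add_le) (use ui Yi in auto)
      also have "J (\<lambda>x. (1 - s) * u n x) \<le> (\<integral>x. (1 - s) * huber (u n x) \<partial>M)"
        unfolding J_def
        by (rule integral_mono) (use s ui in \<open>auto intro!: integrable_huber huber_mult_le\<close>)
      also have "(\<integral>x. (1 - s) * huber (u n x) \<partial>M) = (1 - s) * J (u n)"
        by (simp add: J_def)
      also have "(\<integral>x. clip ((1 - s) * u n x) * (s * Y x) \<partial>M)
          \<le> (\<integral>x. s * (\<bar>clip (u n x)\<bar> * \<bar>Y x\<bar>) \<partial>M)"
      proof (rule integral_mono)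
        show "integrable M (\<lambda>x. clip ((1 - s) * u n x) * (s * Y x))"
          by (rule integrable_clip_mult) (use Yi in auto)
        show "integrable M (\<lambda>x. s * (\<bar>clip (u n x)\<bar> * \<bar>Y x\<bar>))"
          using integrable_clip_mult[OF Yi uM, of n] by (simp flip: abs_mult)
        fix x
        have "clip ((1 - s) * u n x) * (s * Y x) \<le> \<bar>clip ((1 - s) * u n x)\<bar> * \<bar>s * Y x\<bar>"
          by (metis abs_ge_self abs_mult)
        also have "\<dots> \<le> \<bar>clip (u n x)\<bar> * \<bar>s * Y x\<bar>"
          using s by (intro mult_right_mono abs_clip_mult_le) auto
        finally show "clip ((1 - s) * u n x) * (s * Y x) \<le> s * (\<bar>clip (u n x)\<bar> * \<bar>Y x\<bar>)"
          using s by (simp add: abs_mult ac_simps)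
      qed
      finally show ?thesis using Rs by simp
    qed
    have "(\<lambda>n. \<integral>x. \<bar>clip (u (r n) x)\<bar> * \<bar>Y x\<bar> \<partial>M) \<longlonglongrightarrow> (\<integral>x. 0 \<partial>M)"
    proof (rule integral_dominated_convergence[where w = "\<lambda>x. \<bar>Y x\<bar>"])
      show "AE x in M. (\<lambda>n. \<bar>clip (u (r n) x)\<bar> * \<bar>Y x\<bar>) \<longlonglongrightarrow> 0"
        using clip_lim by eventually_elim (intro tendsto_mult_left_zero tendsto_rabs_zero)
      show "AE x in M. norm (\<bar>clip (u (r n) x)\<bar> * \<bar>Y x\<bar>) \<le> \<bar>Y x\<bar>" for n
        by (simp add: abs_clip_le_1 mult_left_le_one_le)
    qed (use Yi in auto)
    then have "(\<lambda>n. (1 - s) * J (u (r n)) + s * (\<integral>x. \<bar>clip (u (r n) x)\<bar> * \<bar>Y x\<bar> \<partial>M) + e * s)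
        \<longlonglongrightarrow> (1 - s) * m + s * 0 + e * s"
      by (intro tendsto_intros J_lim) simp
    then have "m \<le> (1 - s) * m + s * 0 + e * s"
      by (rule Lim_bounded2) (use step in auto)
    then have "s * m \<le> s * e" by (simp add: algebra_simps)
    then show "m \<le> 0 + e" using s by simp
  qed

  \<comment> \<open>Half of \<open>\<epsilon>\<close> pays for the additive term in
    \<open>abs_le_huber\<close>, the other half for \<open>C\<close> times the excess over
    \<open>m\<close>.\<close>
  define \<mu> where "\<mu> = measure M (space M)"
  define h where "h = \<epsilon> / (2 * (\<mu> + 1))"
  define C where "C = 2 + 1 / (2 * h)"
  have "0 \<le> \<mu>" by (simp add: \<mu>_def)
  then have h: "0 < h" "h * \<mu> < \<epsilon> / 2" using \<epsilon> by (auto simp: h_def field_simps)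
  have C: "0 < C" using h by (simp add: C_def add_pos_pos)
  obtain V where V: "V \<in> S" and JV: "J (\<lambda>x. Y x - V x) < m + \<epsilon> / (2 * C)"
    using near[of "\<epsilon> / (2 * C)"] \<epsilon> C by auto
  have Vi: "integrable M (\<lambda>x. Y x - V x)" using Yi Si[OF V] by simp
  have "L1_norm M (Y - V) = (\<integral>x. \<bar>Y x - V x\<bar> \<partial>M)"
    by (simp add: L1_norm_def)
  also have "\<dots> \<le> (\<integral>x. h + C * huber (Y x - V x) \<partial>M)"
    unfolding C_def
    by (rule integral_mono)
      (use Vi integrable_huber[OF Vi] abs_le_huber[OF h(1)] in auto)
  also have "\<dots> = h * \<mu> + C * J (\<lambda>x. Y x - V x)"
    using integrable_huber[OF Vi] by (simp add: J_def \<mu>_def mult.commute)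
  also have "\<dots> < \<epsilon> / 2 + C * (\<epsilon> / (2 * C))"
    using h C JV \<open>m \<le> 0\<close> by (intro add_strict_mono mult_strict_left_mono) auto
  also have "\<dots> = \<epsilon>" using C by simp
  finally show "\<exists>Z\<in>S. L1_norm M (Y - Z) < \<epsilon>" using V by blast
qed

section \<open>Null sets and spans\<close>

text \<open>The exceptional set of a measurable \<open>Q\<close> belongs to \<open>sets X\<close>,
  so the null set condition on \<open>P0\<close> applies to it.\<close>

lemma AE_privileged_iff:
  assumes exp: "statistical_experiment X \<Theta> P"
    and priv: "privileged_dominating_measure X \<Theta> P P0"
    and Q: "Measurable.pred X Q"
  shows "(AE x in P0. Q x) \<longleftrightarrow> (\<forall>\<theta>\<in>\<Theta>. AE x in P \<theta>. Q x)"
proof -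
  interpret statistical_experiment X \<Theta> P by fact
  have sets0: "sets P0 = sets X" and pr0: "prob_space P0"
    using priv by (auto simp: privileged_dominating_measure_def)
  define B where "B = {x \<in> space X. \<not> Q x}"
  have B: "B \<in> sets X" unfolding B_def using Q by measurable
  have AE: "(AE x in N. Q x) \<longleftrightarrow> measure N B = 0" if "prob_space N" "sets N = sets X" for N
  proof -
    interpret prob_space N by fact
    have "B \<in> sets N" using B that by simp
    moreover have "B = {x \<in> space N. \<not> Q x}"
      using sets_eq_imp_space_eq[OF that(2)] by (simp add: B_def)
    ultimately show ?thesis
      by (subst AE_iff_measurable[of B]) (auto simp: emeasure_eq_measure)
  qed
  show ?thesis
    using priv B AE[OF pr0 sets0] AE[OF prob_space_P sets_P]
    by (auto simp: privileged_dominating_measure_def)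
qed

lemma
  shows fun_span_base: "f \<in> T \<Longrightarrow> f \<in> fun_span T"
    and fun_span_nonempty: "fun_span T \<noteq> {}"
    and fun_span_add: "f \<in> fun_span T \<Longrightarrow> g \<in> fun_span T \<Longrightarrow> (\<lambda>x. f x + g x) \<in> fun_span T"
    and fun_span_scale: "f \<in> fun_span T \<Longrightarrow> (\<lambda>x. c * f x) \<in> fun_span T"
proof -
  interpret vector_space "\<lambda>(c::real) (f :: 'a \<Rightarrow> real) x. c * f x"
    by (rule vector_space_fun)
  show "fun_span T \<noteq> {}"
    using span_zero[of T] unfolding fun_span_def by (metis empty_iff)
  show "f \<in> T \<Longrightarrow> f \<in> fun_span T"
    "f \<in> fun_span T \<Longrightarrow> (\<lambda>x. c * f x) \<in> fun_span T"
    unfolding fun_span_def using span_base span_scale by auto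
  show "f \<in> fun_span T \<Longrightarrow> g \<in> fun_span T \<Longrightarrow> (\<lambda>x. f x + g x) \<in> fun_span T"
    using span_add[of f T g] unfolding fun_span_def plus_fun_def .
qed

text \<open>One scaled generator is added at a time, so a linear property has to be examined on
  generators only.\<close>

lemma fun_span_induct [consumes 1, case_names zero step]:
  assumes "f \<in> fun_span T" "Q (\<lambda>x. 0)"
    and "\<And>c f g. f \<in> T \<Longrightarrow> Q g \<Longrightarrow> Q (\<lambda>x. c * f x + g x)"
  shows "Q f"
proof -
  interpret vector_space "\<lambda>(c::real) (f :: 'a \<Rightarrow> real) x. c * f x"
    by (rule vector_space_fun)
  show ?thesis
    by (rule span_induct_alt[of f T Q])
      (use assms in \<open>auto simp: fun_span_def plus_fun_def zero_fun_def\<close>)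
qed

section \<open>Bounded completeness as triviality of annihilators\<close>

theorem proposition1:
  fixes X :: "'a measure" and \<Theta> :: "'t set" and P :: "'t \<Rightarrow> 'a measure"
    and P0 :: "'a measure" and B0 :: "'a measure"
  assumes "statistical_experiment X \<Theta> P"
    and "privileged_dominating_measure X \<Theta> P P0"
    and "subalgebra X B0"
  shows "boundedly_complete \<Theta> P B0 \<longleftrightarrow> dense_in_L1 B0 P0 (density_span \<Theta> P P0 B0)"
proof -
  interpret statistical_experiment X \<Theta> P by fact
  have sets0: "sets P0 = sets X" and "prob_space P0"
    and ac: "\<And>\<theta>. \<theta> \<in> \<Theta> \<Longrightarrow> absolutely_continuous P0 (P \<theta>)"
    using assms(2) by (auto simp: privileged_dominating_measure_def)
  interpret P0: prob_space P0 by fact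
  have sub: "subalgebra P0 B0"
    using assms(3) sets0 sets_eq_imp_space_eq[OF sets0] by (simp add: subalgebra_def)
  interpret P0: finite_measure_subalgebra P0 B0 by standard (rule sub)
  define D where "D \<theta> x = enn2real (RN_deriv P0 (P \<theta>) x)" for \<theta> x
  \<comment> \<open>For \<open>\<theta>\<close> in \<open>\<Theta>\<close> this is a version of the
    density of \<open>P \<theta>\<close> with respect to \<open>P0\<close> on
    \<open>B0\<close>.\<close>
  define W where "W \<theta> = real_cond_exp P0 B0 (D \<theta>)" for \<theta>
  define S where "S = density_span \<Theta> P P0 B0"
  have S_eq: "S = fun_span {W \<theta> | \<theta>. \<theta> \<in> \<Theta>}"
    unfolding S_def density_span_def W_def D_def ..
  have AE_iff: "(AE x in P0. Q x) \<longleftrightarrow> (\<forall>\<theta>\<in>\<Theta>. AE x in P \<theta>. Q x)" if "Measurable.pred B0 Q" for Q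
    using AE_privileged_iff[OF assms(1,2) measurable_from_subalg[OF assms(3) that]] .
  have meas0: "f \<in> borel_measurable P0" if "f \<in> borel_measurable B0" for f :: "'a \<Rightarrow> real"
    by (rule measurable_from_subalg[OF sub that])
  have integral_P: "(\<integral>x. f x \<partial>P \<theta>) = (\<integral>x. D \<theta> x * f x \<partial>P0)"
    and integrable_P: "integrable (P \<theta>) f \<longleftrightarrow> integrable P0 (\<lambda>x. D \<theta> x * f x)"
    if "\<theta> \<in> \<Theta>" "f \<in> borel_measurable P0" for \<theta> and f :: "'a \<Rightarrow> real"
  proof -
    interpret N: prob_space "P \<theta>" using that(1) by (rule prob_space_P)
    have s: "sets (P \<theta>) = sets P0" using sets_P[OF that(1)] sets0 by simp
    show "(\<integral>x. f x \<partial>P \<theta>) = (\<integral>x. D \<theta> x * f x \<partial>P0)"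
      "integrable (P \<theta>) f \<longleftrightarrow> integrable P0 (\<lambda>x. D \<theta> x * f x)"
      unfolding D_def
      by (rule P0.RN_deriv_integral P0.RN_deriv_integrable, (fact | rule ac s that N.sigma_finite_measure_axioms)+)+
  qed
  have Di: "integrable P0 (D \<theta>)" if "\<theta> \<in> \<Theta>" for \<theta>
  proof -
    interpret N: prob_space "P \<theta>" using that by (rule prob_space_P)
    \<comment> \<open>The constant 1 is integrable under the probability measure
      \<open>P \<theta>\<close>, hence its density is integrable under \<open>P0\<close>.\<close>
    show ?thesis using integrable_P[OF that, of "\<lambda>_. 1"] by simp
  qed
  have W: "W \<theta> \<in> borel_measurable B0" "integrable P0 (W \<theta>)" if "\<theta> \<in> \<Theta>" for \<theta>
    unfolding W_def using P0.real_cond_exp_int(1)[OF Di[OF that]] by auto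
  \<comment> \<open>A \<open>B0\<close>-measurable factor passes through the conditional
    expectation; boundedness of \<open>f\<close> secures integrability of the product.\<close>
  have integral_W: "(\<integral>x. f x * W \<theta> x \<partial>P0) = (\<integral>x. f x \<partial>P \<theta>)"
    if "\<theta> \<in> \<Theta>" "f \<in> borel_measurable B0" "AE x in P0. \<bar>f x\<bar> \<le> K" for \<theta> f K
  proof -
    have "integrable P0 (\<lambda>x. f x * D \<theta> x)"
      by (rule integrable_mult_bounded[OF Di meas0]) (use that in auto)
    then have "(\<integral>x. f x * W \<theta> x \<partial>P0) = (\<integral>x. f x * D \<theta> x \<partial>P0)"
      unfolding W_def using that Di[OF that(1)] by (intro P0.real_cond_exp_intg) auto
    then show ?thesis using integral_P[OF that(1) meas0[OF that(2)]] by (simp add: mult.commute)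
  qed
  have S_L1: "S \<subseteq> L1_space B0 P0"
  proof
    fix V assume "V \<in> S"
    then show "V \<in> L1_space B0 P0"
      unfolding S_eq by (induction rule: fun_span_induct)
        (auto simp: L1_space_def W intro!: borel_measurable_add borel_measurable_times)
  qed
  have orth_iff: "(\<forall>V\<in>S. (\<integral>x. f x * V x \<partial>P0) = 0) \<longleftrightarrow> (\<forall>\<theta>\<in>\<Theta>. (\<integral>x. f x \<partial>P \<theta>) = 0)"
    if f: "f \<in> borel_measurable B0" "AE x in P0. \<bar>f x\<bar> \<le> K" for f K
  proof
    assume "\<forall>V\<in>S. (\<integral>x. f x * V x \<partial>P0) = 0"
    moreover have "W \<theta> \<in> S" if "\<theta> \<in> \<Theta>" for \<theta>
      unfolding S_eq using that by (intro fun_span_base) auto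
    ultimately show "\<forall>\<theta>\<in>\<Theta>. (\<integral>x. f x \<partial>P \<theta>) = 0"
      using integral_W[OF _ f] by auto
  next
    assume zero: "\<forall>\<theta>\<in>\<Theta>. (\<integral>x. f x \<partial>P \<theta>) = 0"
    note mult = integrable_mult_bounded[OF _ meas0[OF f(1)] f(2)]
    \<comment> \<open>Integrability is carried along because linearity of the integral needs it for
      the partial combination \<open>V'\<close>.\<close>
    have "integrable P0 V \<and> (\<integral>x. f x * V x \<partial>P0) = 0" if "V \<in> S" for V
      using that unfolding S_eq
    proof (induction rule: fun_span_induct)
      case (step c V V')
      then obtain \<theta> where \<theta>: "\<theta> \<in> \<Theta>" "V = W \<theta>" by auto
      have "(\<integral>x. f x * (c * V x + V' x) \<partial>P0)
          = c * (\<integral>x. f x * V x \<partial>P0) + (\<integral>x. f x * V' x \<partial>P0)"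
        using mult[of V] mult[of V'] W(2)[OF \<theta>(1)] step(2) \<theta>(2)
        by (simp add: distrib_left mult.left_commute)
      then show ?case
        using integral_W[OF \<theta>(1) f] zero W(2)[OF \<theta>(1)] step(2) \<theta> by simp
    qed auto
    then show "\<forall>V\<in>S. (\<integral>x. f x * V x \<partial>P0) = 0" by blast
  qed
  \<comment> \<open>One bound \<open>K\<close> serves all \<open>\<theta>\<close>, so for fixed
    \<open>K\<close> the common null sets transfer the event.\<close>
  have bounded_iff: "essentially_bounded \<Theta> P f \<longleftrightarrow> (\<exists>K\<ge>0. AE x in P0. \<bar>f x\<bar> \<le> K)"
    if [measurable]: "f \<in> borel_measurable B0" for f
  proof -
    have "measure (P \<theta>) {x \<in> space (P \<theta>). \<bar>f x\<bar> \<le> K} = 1 \<longleftrightarrow> (AE x in P \<theta>. \<bar>f x\<bar> \<le> K)"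
      if "\<theta> \<in> \<Theta>" for \<theta> K
    proof -
      interpret N: prob_space "P \<theta>" using that by (rule prob_space_P)
      have [measurable]: "f \<in> borel_measurable (P \<theta>)"
        using meas0[OF \<open>f \<in> borel_measurable B0\<close>] sets_P[OF that] sets0
        by (simp cong: measurable_cong_sets)
      show ?thesis by (rule N.prob_Collect_eq_1) measurable
    qed
    then show ?thesis
      unfolding essentially_bounded_def by (subst AE_iff) auto
  qed
  show ?thesis
    unfolding S_def[symmetric]
  proof
    assume complete: "boundedly_complete \<Theta> P B0"
    show "dense_in_L1 B0 P0 S"
    proof (rule P0.dense_in_L1I[OF sub S_L1])
      fix g :: "'a \<Rightarrow> real"
      assume g: "g \<in> borel_measurable B0" "\<And>x. \<bar>g x\<bar> \<le> 1"
        and orth: "\<And>V. V \<in> S \<Longrightarrow> (\<integral>x. g x * V x \<partial>P0) = 0"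
      have b: "AE x in P0. \<bar>g x\<bar> \<le> 1" using g(2) by simp
      have "essentially_bounded \<Theta> P g"
        unfolding bounded_iff[OF g(1)] using b by (intro exI[of _ 1]) simp
      then have "\<forall>\<theta>\<in>\<Theta>. AE x in P \<theta>. g x = 0"
        using complete g(1) orth orth_iff[OF g(1) b] unfolding boundedly_complete_def by blast
      then show "AE x in P0. g x = 0" using g(1) by (subst AE_iff) auto
    qed (auto simp: S_eq fun_span_nonempty fun_span_add fun_span_scale)
  next
    assume dense: "dense_in_L1 B0 P0 S"
    show "boundedly_complete \<Theta> P B0"
      unfolding boundedly_complete_def
    proof (intro ballI impI, elim conjE)
      fix Y \<theta>
      assume Y [measurable]: "Y \<in> borel_measurable B0" and bounded: "essentially_bounded \<Theta> P Y"
        and zero: "\<forall>\<theta>\<in>\<Theta>. (\<integral>x. Y x \<partial>P \<theta>) = 0" and \<theta>: "\<theta> \<in> \<Theta>"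
      obtain K where K: "AE x in P0. \<bar>Y x\<bar> \<le> K"
        using bounded bounded_iff[OF Y] by auto
      have "AE x in P0. Y x = 0"
        by (rule P0.dense_in_L1_annihilator_trivial[OF sub dense Y K])
          (use orth_iff[OF Y K] zero in blast)
      then show "AE x in P \<theta>. Y x = 0"
        using AE_iff[of "\<lambda>x. Y x = 0"] \<theta> by auto
    qed
  qed
qed

end
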